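(* Let $E$ be a reflexive real Banach space and let $f:E\to\mathbb{R}$ be an admissible Bregman generator. Let $\{T_k\}_{k\ge1}$ be mappings from $E$ into itself, and let $\Gamma$ be a family of closed mappings $E\to E$ such that $$\bigcap_{k=1}^{\infty}\operatorname{Fix}(T_k)=F(\Gamma)\neq\varnothing .$$ Assume that $F(\Gamma)$ is closed and convex, that $\{T_k\}$ satisfies the NST-condition with $\Gamma$, and that there is a sequence $\{\varepsilon_k\}\subset[0,\infty)$ with $\varepsilon_k\to0$ such that $$D_f(p,T_kx)\le D_f(p,x)+\varepsilon_k\qquad\text{for all } x\in E,\ p\in F(\Gamma),\ k\ge1 .$$ Let $\overline\alpha<1$ and $0\le\alpha_k\le\overline\alpha$ for every $k$, and let $\{\beta_k\}\subset\mathbb{R}$ be bounded. Given $v_0\in E$, set $v_1=v_0$ and $C_1=E$, and for $k\ge 1$ define $$\begin{aligned} w_k&=v_k+\beta_k(v_k-v_{k-1}),\\ y_k&=\nabla f^*\bigl(\alpha_k\nabla f(w_k)+(1-\alpha_k)\nabla f(T_kw_k)\bigr),\\ C_{k+1}&=\bigl\{v\in C_k:\ D_f(v,y_k)\le D_f(v,w_k)+(1-\alpha_k)\varepsilon_k\bigr\},\\ v_{k+1}&=P^f_{C_{k+1}}v_0 . \end{aligned}$$ Then every $C_k$ is nonempty, closed, and convex, the iteration is well defined, and $v_k\to P^f_{F(\Gamma)}v_0$ strongly (in norm).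
   Context: $E^*$ is the dual of $E$. For $f:E\to\mathbb{R}$ convex and Gâteaux differentiable, the Bregman distance is $D_f(x,y)=f(x)-f(y)-\langle x-y,\nabla f(y)\rangle$, and $f^*$ is the Fenchel conjugate of $f$. For $D\subset E$ nonempty, closed and convex, the Bregman projection is $P^f_Dx=\operatorname{argmin}_{z\in D}D_f(z,x)$. For $E$ reflexive, $f:E\to\mathbb{R}$ (convex and Gâteaux differentiable) is an admissible Bregman generator if: (1) $f$ is Legendre and strongly coercive; (2) $f$ is bounded on bounded subsets of $E$ and uniformly Fréchet differentiable on bounded subsets of $E$; (3) $f$ is uniformly convex on bounded subsets of $E$; (4) for every $x\in E$ and $r>0$, the set $\{y\in E: D_f(x,y)\le r\}$ is bounded. These terms have their standard meanings. Legendre: both $f$ and $f^*$ have domains with nonempty interior, are Gâteaux differentiable on the interior of their domains, and their subdifferentials are empty outside that interior (here $\operatorname{dom} f=E$). Strongly coercive: $f(x)/\|x\|\to\infty$ as $\|x\|\to\infty$. Uniformly Fréchet differentiable on bounded sets: for each bounded $B\subset E$, $\lim_{t\to0}(f(x+ty)-f(x))/t=\langle y,\nabla f(x)\rangle$ uniformly over $x\in B$, $\|y\|=1$. Uniformly convex on bounded sets: for all $r,t>0$, $\inf\frac{\lambda f(x)+(1-\lambda)f(y)-f(\lambda x+(1-\lambda)y)}{\lambda(1-\lambda)}>0$, the infimum being over $\|x\|,\|y\|\le r$, $\|x-y\|=t$, $\lambda\in(0,1)$. For an admissible generator, $\nabla f:E\to E^*$ is a bijection with inverse $\nabla f^*$.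 $\operatorname{Fix}(T)=\{x\in E:Tx=x\}$, and $F(\Gamma):=\bigcap_{T\in\Gamma}\operatorname{Fix}(T)$. A mapping $T:E\to E$ is closed if its graph is closed in $E\times E$ (norm topology). NST-condition: given $\{T_k\}_{k\ge1}$ and $\Gamma$ with $\bigcap_k\operatorname{Fix}(T_k)=F(\Gamma)\ne\varnothing$, the sequence $\{T_k\}$ satisfies the NST-condition with $\Gamma$ if for every bounded sequence $\{x_k\}\subset E$, $\|x_k-T_kx_k\|\to0$ implies $\|x_k-Tx_k\|\to0$ for every $T\in\Gamma$. *)

theory Defs
  imports "HOL-Analysis.Analysis"
begin

text \<open>The dual of \<^typ>\<open>'a\<close> is the type of bounded linear functionals with the operator norm.
  Reflexivity is surjectivity of the canonical embedding into the bidual.\<close>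

lift_definition bidual_embedding :: "'a::real_normed_vector \<Rightarrow> ('a \<Rightarrow>\<^sub>L real) \<Rightarrow>\<^sub>L real"
  is "\<lambda>x \<phi>. blinfun_apply \<phi> x"
  by (rule blinfun.bounded_linear_left)

text \<open>Convex analysis is set up for extended-real-valued functions, because the conjugate of a
  real-valued function may take the value \<open>\<infinity>\<close>. The difference quotient is taken in
  \<^typ>\<open>ereal\<close>; as its limit is finite, it is eventually finite along every line.\<close>

definition edom :: "('a \<Rightarrow> ereal) \<Rightarrow> 'a set" where
  "edom g = {x. g x < \<infinity>}"

definition has_gateaux_derivative ::
    "('a::real_normed_vector \<Rightarrow> ereal) \<Rightarrow> ('a \<Rightarrow>\<^sub>L real) \<Rightarrow> 'a \<Rightarrow> bool" where
  "has_gateaux_derivative g A x \<longleftrightarrow> \<bar>g x\<bar> \<noteq> \<infinity> \<and>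
     (\<forall>h. ((\<lambda>t. (g (x + t *\<^sub>R h) - g x) / ereal t) \<longlongrightarrow> ereal (blinfun_apply A h)) (at 0))"

definition gateaux_differentiable_on ::
    "('a::real_normed_vector \<Rightarrow> ereal) \<Rightarrow> 'a set \<Rightarrow> bool" where
  "gateaux_differentiable_on g S \<longleftrightarrow> (\<forall>x\<in>S. \<exists>A. has_gateaux_derivative g A x)"

definition gateaux_gradient ::
    "('a::real_normed_vector \<Rightarrow> ereal) \<Rightarrow> 'a \<Rightarrow> ('a \<Rightarrow>\<^sub>L real)" where
  "gateaux_gradient g x = (THE A. has_gateaux_derivative g A x)"

definition subdifferential ::
    "('a::real_normed_vector \<Rightarrow> ereal) \<Rightarrow> 'a \<Rightarrow> ('a \<Rightarrow>\<^sub>L real) set" where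
  "subdifferential g x =
     {A. x \<in> edom g \<and> (\<forall>y. g x + ereal (blinfun_apply A (y - x)) \<le> g y)}"

definition fenchel_conjugate ::
    "('a::real_normed_vector \<Rightarrow> ereal) \<Rightarrow> ('a \<Rightarrow>\<^sub>L real) \<Rightarrow> ereal" where
  "fenchel_conjugate g \<phi> = (SUP x. ereal (blinfun_apply \<phi> x) - g x)"

definition legendre :: "('a::real_normed_vector \<Rightarrow> ereal) \<Rightarrow> bool" where
  "legendre g \<longleftrightarrow>
     interior (edom g) \<noteq> {} \<and>
     gateaux_differentiable_on g (interior (edom g)) \<and>
     (\<forall>x. x \<notin> interior (edom g) \<longrightarrow> subdifferential g x = {}) \<and>
     interior (edom (fenchel_conjugate g)) \<noteq> {} \<and>
     gateaux_differentiable_on (fenchel_conjugate g) (interior (edom (fenchel_conjugate g))) \<and>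
     (\<forall>\<phi>. \<phi> \<notin> interior (edom (fenchel_conjugate g)) \<longrightarrow>
        subdifferential (fenchel_conjugate g) \<phi> = {})"

abbreviation grad :: "('a::real_normed_vector \<Rightarrow> real) \<Rightarrow> 'a \<Rightarrow> ('a \<Rightarrow>\<^sub>L real)" where
  "grad f \<equiv> gateaux_gradient (\<lambda>x. ereal (f x))"

abbreviation conj_fun :: "('a::real_normed_vector \<Rightarrow> real) \<Rightarrow> ('a \<Rightarrow>\<^sub>L real) \<Rightarrow> ereal" where
  "conj_fun f \<equiv> fenchel_conjugate (\<lambda>x. ereal (f x))"

text \<open>The gradient of the conjugate lives in the bidual; in a reflexive space it is identified
  with a point of the space.\<close>

definition grad_conj :: "('a::real_normed_vector \<Rightarrow> real) \<Rightarrow> ('a \<Rightarrow>\<^sub>L real) \<Rightarrow> 'a" where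
  "grad_conj f \<phi> = inv bidual_embedding (gateaux_gradient (conj_fun f) \<phi>)"

definition bregman_dist :: "('a::real_normed_vector \<Rightarrow> real) \<Rightarrow> 'a \<Rightarrow> 'a \<Rightarrow> real" where
  "bregman_dist f x y = f x - f y - blinfun_apply (grad f y) (x - y)"

text \<open>\<^const>\<open>arg_min_on\<close> is a choice operator, so it denotes the projection only where a unique
  minimizer (\<open>has_bregman_proj\<close>) exists.\<close>

definition bregman_proj :: "('a::real_normed_vector \<Rightarrow> real) \<Rightarrow> 'a set \<Rightarrow> 'a \<Rightarrow> 'a" where
  "bregman_proj f D x = arg_min_on (\<lambda>z. bregman_dist f z x) D"

definition has_bregman_proj :: "('a::real_normed_vector \<Rightarrow> real) \<Rightarrow> 'a set \<Rightarrow> 'a \<Rightarrow> bool" where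
  "has_bregman_proj f D x \<longleftrightarrow>
     (\<exists>!z. is_arg_min (\<lambda>z. bregman_dist f z x) (\<lambda>z. z \<in> D) z)"

definition strongly_coercive :: "('a::real_normed_vector \<Rightarrow> real) \<Rightarrow> bool" where
  "strongly_coercive f \<longleftrightarrow> filterlim (\<lambda>x. f x / norm x) at_top at_infinity"

definition bounded_on_bounded :: "('a::real_normed_vector \<Rightarrow> real) \<Rightarrow> bool" where
  "bounded_on_bounded f \<longleftrightarrow> (\<forall>B. bounded B \<longrightarrow> bounded (f ` B))"

definition unif_frechet_on_bounded :: "('a::real_normed_vector \<Rightarrow> real) \<Rightarrow> bool" where
  "unif_frechet_on_bounded f \<longleftrightarrow>
     (\<forall>B. bounded B \<longrightarrow>
        uniform_limit (B \<times> sphere 0 1)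
          (\<lambda>t (x, y). (f (x + t *\<^sub>R y) - f x) / t)
          (\<lambda>(x, y). blinfun_apply (grad f x) y)
          (at 0))"

text \<open>The infimum is taken in \<^typ>\<open>ereal\<close>, where the infimum of the empty set
  (the case \<open>t > 2 * r\<close>) is \<open>\<infinity>\<close>.\<close>

definition unif_convex_on_bounded :: "('a::real_normed_vector \<Rightarrow> real) \<Rightarrow> bool" where
  "unif_convex_on_bounded f \<longleftrightarrow>
     (\<forall>r>0. \<forall>t>0.
        0 < (INF (x, y, l) \<in> {(x, y, l). norm x \<le> r \<and> norm y \<le> r \<and> norm (x - y) = t \<and> 0 < l \<and> l < 1}.
               ereal ((l * f x + (1 - l) * f y - f (l *\<^sub>R x + (1 - l) *\<^sub>R y)) / (l * (1 - l)))))"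

definition admissible_generator :: "('a::real_normed_vector \<Rightarrow> real) \<Rightarrow> bool" where
  "admissible_generator f \<longleftrightarrow>
     convex_on UNIV f \<and>
     gateaux_differentiable_on (\<lambda>x. ereal (f x)) UNIV \<and>
     legendre (\<lambda>x. ereal (f x)) \<and> strongly_coercive f \<and>
     bounded_on_bounded f \<and> unif_frechet_on_bounded f \<and>
     unif_convex_on_bounded f \<and>
     (\<forall>x. \<forall>r>0. bounded {y. bregman_dist f x y \<le> r})"

definition Fix :: "('a \<Rightarrow> 'a) \<Rightarrow> 'a set" where
  "Fix T = {x. T x = x}"

definition common_Fix :: "('a \<Rightarrow> 'a) set \<Rightarrow> 'a set" where
  "common_Fix \<Gamma> = (\<Inter>T\<in>\<Gamma>. Fix T)"

definition closed_mapping :: "('a::topological_space \<Rightarrow> 'a) \<Rightarrow> bool" where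
  "closed_mapping T \<longleftrightarrow> closed {(x, y). y = T x}"

text \<open>Sequences are indexed from 1; values at index 0 are irrelevant.\<close>

definition NST_condition ::
    "(nat \<Rightarrow> 'a::real_normed_vector \<Rightarrow> 'a) \<Rightarrow> ('a \<Rightarrow> 'a) set \<Rightarrow> bool" where
  "NST_condition T \<Gamma> \<longleftrightarrow>
     (\<forall>x. bounded (x ` {1..}) \<longrightarrow> (\<lambda>k. norm (x k - T k (x k))) \<longlonglongrightarrow> 0 \<longrightarrow>
        (\<forall>S\<in>\<Gamma>. (\<lambda>k. norm (x k - S (x k))) \<longlonglongrightarrow> 0))"

end

theory Submission
  imports Defs
begin

text \<open>Write \<open>F\<close> for the common fixed point set and \<open>D\<close> for the Bregman distance.

  Each inequality \<open>D u y \<le> D u w + c\<close> is affine in \<open>u\<close>, because the term \<open>f u\<close> cancels; so every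
  \<open>C k\<close> is an intersection of closed half-spaces (\<open>closed_convex_bregman_halfspace\<close>). It contains
  \<open>F\<close>: averaging gradients does not increase \<open>D p\<close> beyond the average of the distances
  (\<open>bregman_dist_mixture\<close>), and \<open>T k\<close> raises \<open>D p\<close> by at most \<open>\<epsilon> k\<close> for \<open>p\<close> in \<open>F\<close>. The iteration is
  therefore meaningful as soon as projections onto closed convex sets exist and the gradient of
  \<open>f\<close> is inverted by that of the conjugate.

  Both of these come from one mechanism, which produces Cauchy sequences in norm. Uniform convexity gives a fixed gain at the midpoint of two points that are far
  apart (\<open>midpoint_gap\<close>). Hence a sequence whose values under \<open>f - \<phi>\<close> converge, while the values at
  midpoints are asymptotically no smaller, is Cauchy (\<open>Cauchy_of_midpoint_values\<close>). Applied to a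
  minimizing sequence, this gives a unique minimizer of \<open>f - \<phi>\<close> on every nonempty closed convex set
  (\<open>ex1_minimizer\<close>). With \<open>\<phi>\<close> the gradient at \<open>x\<close> the minimizer is the Bregman projection of \<open>x\<close>.
  On the whole space it is a solution of \<open>grad f u = \<phi>\<close>, at which the supremum defining the conjugate
  is attained, and so \<open>u\<close> is the gradient of the conjugate at \<open>\<phi>\<close> (\<open>conj_gateaux_grad\<close>). Applied to
  projections onto a decreasing sequence of sets, the same mechanism shows that \<open>v\<close> converges to a
  point \<open>z\<close> in all \<open>C k\<close> (\<open>nested_projections_converge\<close>).

  It remains to identify \<open>z\<close>. The inertial points \<open>w k\<close> tend to \<open>z\<close> as well, and \<open>z\<close> in \<open>C (k + 1)\<close>
  bounds \<open>D z (y k)\<close> by \<open>D z (w k) + \<epsilon> k\<close>, so \<open>y\<close> tends to \<open>z\<close>. As the weights \<open>1 - \<alpha> k\<close> are bounded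
  away from zero, the gradients at \<open>T k (w k)\<close> tend to the gradient at \<open>z\<close>; the points \<open>T k (w k)\<close>
  stay bounded, and uniform convexity turns the convergence of gradients into convergence of points
  (\<open>tendsto_of_grad\<close>). Thus \<open>w k - T k (w k)\<close> tends to zero, the NST-condition passes this to every
  member of the family, and closedness of its graph makes \<open>z\<close> a fixed point. Since \<open>F\<close> lies in every
  \<open>C k\<close>, each \<open>v k\<close> is at least as close to \<open>v0\<close> as any point of \<open>F\<close>, and so is the limit \<open>z\<close>: it is
  the projection onto \<open>F\<close>.\<close>

section \<open>Gateaux derivatives\<close>

lemma has_gateaux_derivative_unique:
  assumes "has_gateaux_derivative g A x" "has_gateaux_derivative g B x"
  shows "A = B"
proof (rule blinfun_eqI)
  fix h
  have "ereal (A h) = ereal (B h)"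
    using assms unfolding has_gateaux_derivative_def
    by (meson tendsto_unique trivial_limit_at)
  then show "A h = B h" by simp
qed

lemma gateaux_gradient_eqI:
  assumes "has_gateaux_derivative g A x"
  shows "gateaux_gradient g x = A"
  unfolding gateaux_gradient_def
  using assms has_gateaux_derivative_unique by blast

text \<open>For a finite function the extended-real quotient agrees with the real one except at \<open>t = 0\<close>,
  which the limit ignores.\<close>

lemma has_gateaux_derivative_ereal_iff:
  "has_gateaux_derivative (\<lambda>x. ereal (f x)) A x \<longleftrightarrow>
     (\<forall>h. ((\<lambda>t. (f (x + t *\<^sub>R h) - f x) / t) \<longlongrightarrow> blinfun_apply A h) (at 0))"
proof -
  have "((\<lambda>t. (ereal (f (x + t *\<^sub>R h)) - ereal (f x)) / ereal t) \<longlongrightarrow> ereal (A h)) (at 0)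
      \<longleftrightarrow> ((\<lambda>t. ereal ((f (x + t *\<^sub>R h) - f x) / t)) \<longlongrightarrow> ereal (A h)) (at 0)" for h
    by (rule tendsto_cong) (auto simp: eventually_at_filter)
  then show ?thesis
    unfolding has_gateaux_derivative_def by simp
qed

lemma norm_blinfun_le_unit:
  fixes A :: "'a::real_normed_vector \<Rightarrow>\<^sub>L real"
  assumes "0 \<le> e" and "\<And>h. norm h = 1 \<Longrightarrow> A h \<le> e"
  shows "norm A \<le> e"
proof (rule norm_blinfun_bound[OF assms(1)])
  fix h :: 'a
  show "norm (A h) \<le> e * norm h"
  proof (cases "h = 0")
    case False
    have *: "A (sgn h) \<le> e" "A (- sgn h) \<le> e"
      using False by (auto intro!: assms(2) simp: norm_sgn)
    have "A h = norm h * A (sgn h)"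
      using False by (simp add: sgn_div_norm blinfun.scaleR_right)
    moreover have "\<bar>A (sgn h)\<bar> \<le> e"
      using * by (auto simp: blinfun.minus_right)
    ultimately show ?thesis
      using mult_left_mono[OF _ norm_ge_zero[of h]] by (simp add: abs_mult mult.commute[of e])
  qed (simp add: blinfun.zero_right)
qed

section \<open>Admissible Bregman generators\<close>

locale bregman_generator =
  fixes f :: "'a::banach \<Rightarrow> real"
  assumes admissible: "admissible_generator f"
begin

lemma convex: "convex_on UNIV f"
  using admissible unfolding admissible_generator_def by blast

lemma f_segment_le:
  assumes "0 \<le> t" "t \<le> 1"
  shows "f ((1 - t) *\<^sub>R x + t *\<^sub>R y) \<le> (1 - t) * f x + t * f y"
  using convex_onD[OF convex assms] by simp

lemma gateaux_grad: "has_gateaux_derivative (\<lambda>x. ereal (f x)) (grad f x) x"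
proof -
  obtain A where "has_gateaux_derivative (\<lambda>x. ereal (f x)) A x"
    using admissible unfolding admissible_generator_def gateaux_differentiable_on_def by blast
  with gateaux_gradient_eqI[OF this] show ?thesis by simp
qed

lemma grad_limit: "((\<lambda>t. (f (x + t *\<^sub>R h) - f x) / t) \<longlongrightarrow> grad f x h) (at 0)"
  using gateaux_grad[of x] unfolding has_gateaux_derivative_ereal_iff by blast

text \<open>By convexity the difference quotient towards \<open>y\<close> is at most \<open>f y - f x\<close> for every step in
  \<open>(0, 1)\<close>, and so is its limit.\<close>

lemma subgradient: "f x + grad f x (y - x) \<le> f y"
proof -
  have "((\<lambda>t. (f (x + t *\<^sub>R (y - x)) - f x) / t) \<longlongrightarrow> grad f x (y - x)) (at_right 0)"
    using grad_limit by (rule filterlim_mono) (auto simp: at_le)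
  moreover have "eventually (\<lambda>t. (f (x + t *\<^sub>R (y - x)) - f x) / t \<le> f y - f x) (at_right 0)"
    unfolding eventually_at_right[OF zero_less_one]
  proof (intro exI[of _ 1] conjI allI impI)
    fix t :: real assume t: "0 < t" "t < 1"
    have "f (x + t *\<^sub>R (y - x)) \<le> (1 - t) * f x + t * f y"
      using f_segment_le[of t x y] t by (simp add: algebra_simps)
    then show "(f (x + t *\<^sub>R (y - x)) - f x) / t \<le> f y - f x"
      using t by (simp add: field_simps)
  qed auto
  ultimately have "grad f x (y - x) \<le> f y - f x"
    by (rule tendsto_upperbound) simp
  then show ?thesis by simp
qed

lemma bregman_dist_nonneg: "0 \<le> bregman_dist f x y"
  using subgradient[of y x] by (simp add: bregman_dist_def)

lemma bregman_dist_self [simp]: "bregman_dist f x x = 0"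
  by (simp add: bregman_dist_def blinfun.zero_right)

lemma bounded_image: "bounded B \<Longrightarrow> bounded (f ` B)"
  using admissible unfolding admissible_generator_def bounded_on_bounded_def by blast

text \<open>The subgradient inequality bounds \<open>grad f x h\<close> by the oscillation of \<open>f\<close> on a ball that is
  larger by one.\<close>

lemma grad_bounded:
  assumes "bounded B"
  obtains L where "0 \<le> L" "\<And>x. x \<in> B \<Longrightarrow> norm (grad f x) \<le> L"
proof -
  obtain r where r: "\<And>x. x \<in> B \<Longrightarrow> norm x \<le> r"
    using assms bounded_iff by blast
  obtain M where M: "\<And>x. x \<in> cball 0 (r + 1) \<Longrightarrow> norm (f x) \<le> M"
    using bounded_image[OF bounded_cball] unfolding bounded_iff by (metis imageI)
  have "norm (grad f x) \<le> 2 * \<bar>M\<bar>" if "x \<in> B" for x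
  proof (rule norm_blinfun_le_unit)
    fix h :: 'a assume h: "norm h = 1"
    have "norm (x + h) \<le> r + 1" "norm x \<le> r + 1"
      using norm_triangle_ineq[of x h] r[OF that] h by auto
    then have "norm (f (x + h)) \<le> M" "norm (f x) \<le> M" using M by auto
    then show "grad f x h \<le> 2 * \<bar>M\<bar>"
      using subgradient[of x "x + h"] by simp
  qed simp
  then show ?thesis using that[of "2 * \<bar>M\<bar>"] by simp
qed

lemma lipschitz_on_bounded:
  assumes "bounded B"
  obtains L where "0 \<le> L" "\<And>x y. x \<in> B \<Longrightarrow> y \<in> B \<Longrightarrow> \<bar>f x - f y\<bar> \<le> L * norm (x - y)"
proof -
  obtain L where L: "0 \<le> L" "\<And>x. x \<in> B \<Longrightarrow> norm (grad f x) \<le> L"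
    using grad_bounded[OF assms] by blast
  have one_sided: "f x - f y \<le> L * norm (x - y)" if "x \<in> B" for x y
  proof -
    have "f x - f y \<le> - grad f x (y - x)" using subgradient[of x y] by simp
    also have "\<dots> \<le> norm (grad f x (y - x))" by simp
    also have "\<dots> \<le> norm (grad f x) * norm (y - x)" by (rule norm_blinfun)
    also have "\<dots> \<le> L * norm (x - y)"
      using L(2)[OF that] by (simp add: mult_right_mono norm_minus_commute)
    finally show ?thesis .
  qed
  show ?thesis
  proof (rule that[OF L(1)])
    fix x y assume "x \<in> B" "y \<in> B"
    then show "\<bar>f x - f y\<bar> \<le> L * norm (x - y)"
      using one_sided[of x y] one_sided[of y x] by (simp add: norm_minus_commute)
  qed
qed

lemma isCont_f: "isCont f x"
proof -
  obtain L where "0 \<le> L" and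
    L: "\<And>y z. y \<in> cball x 1 \<Longrightarrow> z \<in> cball x 1 \<Longrightarrow> \<bar>f y - f z\<bar> \<le> L * norm (y - z)"
    using lipschitz_on_bounded[OF bounded_cball] by blast
  have "((\<lambda>y. f y - f x) \<longlongrightarrow> 0) (at x)"
  proof (rule Lim_null_comparison)
    have "\<forall>\<^sub>F y in at x. y \<in> cball x 1"
      by (rule eventually_at_in_open'[of "ball x 1", THEN eventually_mono]) auto
    then show "\<forall>\<^sub>F y in at x. norm (f y - f x) \<le> L * norm (y - x)"
      by eventually_elim (use L in auto)
    have "((\<lambda>y. L * norm (y - x)) \<longlongrightarrow> L * norm (x - x)) (at x)"
      by (intro tendsto_intros)
    then show "((\<lambda>y. L * norm (y - x)) \<longlongrightarrow> 0) (at x)" by simp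
  qed
  then show ?thesis unfolding isCont_def using Lim_null by blast
qed

text \<open>Near \<open>x\<close> and along all unit directions the gradient is uniformly approximated by difference
  quotients with one fixed step \<open>t\<close>. Such a quotient is continuous in the base point, uniformly in
  the direction, because \<open>f\<close> is Lipschitz on bounded sets.\<close>

lemma isCont_grad: "isCont (grad f) x"
  unfolding isCont_def tendsto_iff
proof (intro allI impI)
  fix e :: real assume "0 < e"
  let ?B = "cball x 1"
  have "uniform_limit (?B \<times> sphere 0 1) (\<lambda>t (x, y). (f (x + t *\<^sub>R y) - f x) / t)
          (\<lambda>(x, y). grad f x y) (at 0)"
    using admissible unfolding admissible_generator_def unif_frechet_on_bounded_def by simp
  \<comment> \<open>Two approximation errors of \<open>e/6\<close> leave the term \<open>e/3\<close>; the Lipschitz term vanishes as \<open>z\<close>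
    tends to \<open>x\<close>.\<close>
  from uniform_limitD[OF this, of "e/6"] \<open>0 < e\<close>
  have "\<forall>\<^sub>F t in at 0. \<forall>z\<in>?B. \<forall>h. norm h = 1 \<longrightarrow>
          \<bar>(f (z + t *\<^sub>R h) - f z) / t - grad f z h\<bar> < e/6"
    by (auto simp: dist_real_def elim!: eventually_mono)
  moreover have "\<forall>\<^sub>F t in at (0::real). t \<noteq> 0"
    by (simp add: eventually_at_filter)
  ultimately have "\<forall>\<^sub>F t in at (0::real). t \<noteq> 0 \<and> (\<forall>z\<in>?B. \<forall>h. norm h = 1 \<longrightarrow>
          \<bar>(f (z + t *\<^sub>R h) - f z) / t - grad f z h\<bar> < e/6)"
    by eventually_elim auto
  then obtain t :: real where t: "t \<noteq> 0" and quot: "\<And>z h. z \<in> ?B \<Longrightarrow> norm h = 1 \<Longrightarrow>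
          \<bar>(f (z + t *\<^sub>R h) - f z) / t - grad f z h\<bar> < e/6"
    using eventually_happens'[OF at_neq_bot] by blast
  obtain L where "0 \<le> L" and L: "\<And>y z. y \<in> cball x (1 + \<bar>t\<bar>) \<Longrightarrow> z \<in> cball x (1 + \<bar>t\<bar>) \<Longrightarrow>
      \<bar>f y - f z\<bar> \<le> L * norm (y - z)"
    using lipschitz_on_bounded[OF bounded_cball] by blast
  have est: "norm (grad f z - grad f x) \<le> e / 3 + 2 * L / \<bar>t\<bar> * norm (z - x)" if z: "z \<in> ?B" for z
  proof (rule norm_blinfun_le_unit)
    fix h :: 'a assume h: "norm h = 1"
    have in_ball: "z \<in> cball x (1 + \<bar>t\<bar>)" "x \<in> cball x (1 + \<bar>t\<bar>)" "x + t *\<^sub>R h \<in> cball x (1 + \<bar>t\<bar>)"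
      using z h by (auto simp: dist_norm)
    have "norm (x - (z + t *\<^sub>R h)) \<le> norm (x - z) + norm (t *\<^sub>R h)"
      using norm_triangle_ineq4[of "x - z" "t *\<^sub>R h"] by (simp add: algebra_simps)
    then have "z + t *\<^sub>R h \<in> cball x (1 + \<bar>t\<bar>)"
      using z h by (auto simp: dist_norm)
    then have "\<bar>f (z + t *\<^sub>R h) - f (x + t *\<^sub>R h)\<bar> \<le> L * norm (z - x)"
      using L[of "z + t *\<^sub>R h" "x + t *\<^sub>R h"] in_ball by simp
    moreover have "\<bar>f z - f x\<bar> \<le> L * norm (z - x)"
      using L in_ball by blast
    ultimately have "\<bar>(f (z + t *\<^sub>R h) - f (x + t *\<^sub>R h)) - (f z - f x)\<bar> \<le> 2 * L * norm (z - x)"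
      by linarith
    then have "\<bar>((f (z + t *\<^sub>R h) - f (x + t *\<^sub>R h)) - (f z - f x)) / t\<bar> \<le> 2 * L * norm (z - x) / \<bar>t\<bar>"
      using t by (simp add: divide_right_mono)
    moreover have "((f (z + t *\<^sub>R h) - f (x + t *\<^sub>R h)) - (f z - f x)) / t =
        (f (z + t *\<^sub>R h) - f z) / t - (f (x + t *\<^sub>R h) - f x) / t"
      by (simp add: diff_divide_distrib)
    ultimately have "\<bar>(f (z + t *\<^sub>R h) - f z) / t - (f (x + t *\<^sub>R h) - f x) / t\<bar>
        \<le> 2 * L / \<bar>t\<bar> * norm (z - x)" by simp
    moreover have "\<bar>(f (z + t *\<^sub>R h) - f z) / t - grad f z h\<bar> < e/6"
      "\<bar>(f (x + t *\<^sub>R h) - f x) / t - grad f x h\<bar> < e/6"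
      using quot[OF z h] quot[of x h] h by auto
    ultimately show "(grad f z - grad f x) h \<le> e / 3 + 2 * L / \<bar>t\<bar> * norm (z - x)"
      unfolding blinfun.diff_left by linarith
  qed (use \<open>0 \<le> L\<close> \<open>0 < e\<close> in auto)
  have "((\<lambda>z. e / 3 + 2 * L / \<bar>t\<bar> * norm (z - x)) \<longlongrightarrow> e / 3 + 2 * L / \<bar>t\<bar> * norm (x - x)) (at x)"
    by (intro tendsto_intros)
  then have "\<forall>\<^sub>F z in at x. e / 3 + 2 * L / \<bar>t\<bar> * norm (z - x) < e"
    by (rule order_tendstoD(2)) (use \<open>0 < e\<close> in simp)
  moreover have "\<forall>\<^sub>F z in at x. z \<in> ?B"
    by (rule eventually_at_in_open'[of "ball x 1", THEN eventually_mono]) auto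
  ultimately show "\<forall>\<^sub>F z in at x. dist (grad f z) (grad f x) < e"
    by eventually_elim (use est in \<open>force simp: dist_norm\<close>)
qed

lemma tendsto_bregman_dist:
  assumes "(X \<longlongrightarrow> x) F" "(Y \<longlongrightarrow> y) F"
  shows "((\<lambda>n. bregman_dist f (X n) (Y n)) \<longlongrightarrow> bregman_dist f x y) F"
  unfolding bregman_dist_def
  by (intro tendsto_intros blinfun.tendsto isCont_tendsto_compose[OF isCont_f]
      isCont_tendsto_compose[OF isCont_grad] assms)

section \<open>Uniform convexity and minimizing sequences\<close>

text \<open>Uniform convexity in the form in which it produces Cauchy sequences: it covers all pairs at
  distance at least \<open>t\<close> with one constant.\<close>

lemma midpoint_gap:
  assumes "0 < r" "0 < t"
  obtains c where "0 < c"
    "\<And>x y. norm x \<le> r \<Longrightarrow> norm y \<le> r \<Longrightarrow> t \<le> norm (x - y) \<Longrightarrow>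
       f ((1/2) *\<^sub>R (x + y)) + c \<le> (f x + f y) / 2"
proof -
  let ?S = "{(x, y, l). norm x \<le> r \<and> norm y \<le> r \<and> norm (x - y) = t \<and> 0 < l \<and> l < (1::real)}"
  let ?q = "\<lambda>(x, y, l). ereal ((l * f x + (1 - l) * f y - f (l *\<^sub>R x + (1 - l) *\<^sub>R y)) / (l * (1 - l)))"
  have "0 < (INF z\<in>?S. ?q z)"
    using admissible assms unfolding admissible_generator_def unif_convex_on_bounded_def by blast
  then obtain c where c: "0 < ereal c" "ereal c < (INF z\<in>?S. ?q z)"
    using ereal_dense2 by blast
  have exact: "f ((1/2) *\<^sub>R (x + y)) + c / 4 \<le> (f x + f y) / 2"
    if "norm x \<le> r" "norm y \<le> r" "norm (x - y) = t" for x y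
  proof -
    have "(INF z\<in>?S. ?q z) \<le> ?q (x, y, 1/2)"
      by (rule INF_lower) (use that in simp)
    then have "ereal c < ?q (x, y, 1/2)" using c(2) by (rule less_le_trans[rotated])
    moreover have "(1/2) *\<^sub>R x + (1 - 1/2) *\<^sub>R y = (1/2) *\<^sub>R (x + y)"
      by (simp add: scaleR_add_right)
    ultimately have "c < (1/2 * f x + (1 - 1/2) * f y - f ((1/2) *\<^sub>R (x + y))) / (1/2 * (1 - 1/2))"
      by (simp only: prod.case less_ereal.simps)
    then show ?thesis by simp
  qed
  show ?thesis
  proof (rule that[of "c / 4"])
    show "0 < c / 4" using c by simp
    fix x y :: 'a
    assume x: "norm x \<le> r" and y: "norm y \<le> r" and ge: "t \<le> norm (x - y)"
    \<comment> \<open>The hypothesis speaks of distance exactly \<open>t\<close>. Shrinking the segment about its midpoint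
      to length \<open>t\<close> only decreases the gap, by convexity along each half.\<close>
    define \<theta> where "\<theta> = t / norm (x - y)"
    define m where "m = (1/2) *\<^sub>R (x + y)"
    define x' where "x' = (1 - \<theta>) *\<^sub>R m + \<theta> *\<^sub>R x"
    define y' where "y' = (1 - \<theta>) *\<^sub>R m + \<theta> *\<^sub>R y"
    have pos: "0 < norm (x - y)" using assms(2) ge by (rule less_le_trans)
    have \<theta>: "0 < \<theta>" "\<theta> \<le> 1"
      unfolding \<theta>_def using divide_pos_pos[OF assms(2) pos] pos ge
      by (simp_all add: divide_le_eq_1_pos)
    have conv: "convex (cball (0::'a) r)" by simp
    have m: "m \<in> cball 0 r"
      using convexD[OF conv, of x y "1/2" "1/2"] x y by (simp add: m_def scaleR_add_right)
    have "norm x' \<le> r" "norm y' \<le> r"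
      using convexD[OF conv m, of x "1 - \<theta>" \<theta>] convexD[OF conv m, of y "1 - \<theta>" \<theta>] x y \<theta>
      by (simp_all add: x'_def y'_def)
    moreover have "norm (x' - y') = t"
    proof -
      have "x' - y' = \<theta> *\<^sub>R (x - y)" by (simp add: x'_def y'_def algebra_simps)
      then show ?thesis using \<theta> pos assms(2) by (simp add: \<theta>_def)
    qed
    moreover have "(1/2) *\<^sub>R (x' + y') = m"
    proof -
      have "x' + y' = (2 * (1 - \<theta>)) *\<^sub>R m + \<theta> *\<^sub>R (x + y)"
        by (simp only: x'_def y'_def mult_2 mult_2_right scaleR_add_left scaleR_add_right ac_simps)
      moreover have "x + y = 2 *\<^sub>R m" by (simp add: m_def)
      ultimately have "x' + y' = 2 *\<^sub>R m" by (simp add: algebra_simps)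
      then show ?thesis by simp
    qed
    ultimately have "f m + c / 4 \<le> (f x' + f y') / 2"
      using exact[of x' y'] by simp
    moreover have "f x' \<le> (1 - \<theta>) * f m + \<theta> * f x" "f y' \<le> (1 - \<theta>) * f m + \<theta> * f y"
      using f_segment_le \<theta> by (simp_all add: x'_def y'_def)
    ultimately have le: "c / 4 \<le> \<theta> * ((f x + f y) / 2 - f m)"
      by (simp add: field_simps)
    have gap: "0 \<le> (f x + f y) / 2 - f m"
    proof (rule ccontr)
      assume "\<not> 0 \<le> (f x + f y) / 2 - f m"
      then have "\<theta> * ((f x + f y) / 2 - f m) < 0" using \<theta> by (simp add: mult_less_0_iff)
      then show False using le c by simp
    qed
    have "c / 4 \<le> (f x + f y) / 2 - f m"
      using order_trans[OF le mult_right_mono[OF \<theta>(2) gap]] by simp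
    then show "f ((1/2) *\<^sub>R (x + y)) + c / 4 \<le> (f x + f y) / 2"
      unfolding m_def by linarith
  qed
qed

text \<open>A continuous linear functional is affine along segments, so it does not affect the gain at
  the midpoint.\<close>

lemma midpoint_gap_perturbed:
  fixes \<phi> :: "'a \<Rightarrow>\<^sub>L real"
  assumes "f ((1/2) *\<^sub>R (x + y)) + c \<le> (f x + f y) / 2"
  shows "f ((1/2) *\<^sub>R (x + y)) - \<phi> ((1/2) *\<^sub>R (x + y)) + c \<le> ((f x - \<phi> x) + (f y - \<phi> y)) / 2"
proof -
  have "\<phi> ((1/2) *\<^sub>R (x + y)) = (\<phi> x + \<phi> y) / 2"
    by (simp add: blinfun.scaleR_right blinfun.add_right)
  with assms show ?thesis by argo
qed

text \<open>Strong coercivity makes \<open>f\<close> outgrow \<open>\<phi>\<close> by at least the norm far from the origin.\<close>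

lemma bounded_sublevel:
  fixes \<phi> :: "'a \<Rightarrow>\<^sub>L real"
  shows "bounded {x. f x - \<phi> x \<le> s}"
proof -
  have "filterlim (\<lambda>x. f x / norm x) at_top at_infinity"
    using admissible unfolding admissible_generator_def strongly_coercive_def by blast
  then have "\<forall>\<^sub>F x in at_infinity. norm \<phi> + 1 \<le> f x / norm x"
    by (simp add: filterlim_at_top)
  then obtain b where b: "\<And>x. b \<le> norm x \<Longrightarrow> norm \<phi> + 1 \<le> f x / norm x"
    unfolding eventually_at_infinity by blast
  have "norm x \<le> max (max b 1) s" if "f x - \<phi> x \<le> s" for x
  proof (cases "max b 1 \<le> norm x")
    case True
    then have "norm \<phi> + 1 \<le> f x / norm x" "0 < norm x" using b by auto
    then have "norm \<phi> * norm x + norm x \<le> f x" by (simp add: field_simps)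
    moreover have "\<phi> x \<le> norm \<phi> * norm x" using norm_blinfun[of \<phi> x] by simp
    ultimately show ?thesis using that by linarith
  qed auto
  then show ?thesis unfolding bounded_iff by blast
qed

text \<open>Only the sublevel set at \<open>0\<close> matters; it is bounded, and \<open>f\<close> and \<open>\<phi>\<close> are bounded on it.\<close>

lemma bounded_below:
  fixes \<phi> :: "'a \<Rightarrow>\<^sub>L real"
  obtains m where "\<And>x. m \<le> f x - \<phi> x"
proof -
  let ?S = "{x. f x - \<phi> x \<le> 0}"
  have "bounded (f ` ?S)" "bounded (\<phi> ` ?S)"
    using bounded_image bounded_sublevel bounded_linear_image blinfun.bounded_linear_right by blast+
  then obtain M N where M: "\<forall>z\<in>f ` ?S. norm z \<le> M" and N: "\<forall>z\<in>\<phi> ` ?S. norm z \<le> N"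
    unfolding bounded_iff by blast
  have "- \<bar>M\<bar> - \<bar>N\<bar> \<le> f x - \<phi> x" for x
  proof (cases "x \<in> ?S")
    case True
    then have "norm (f x) \<le> M" "norm (\<phi> x) \<le> N" using M N by blast+
    then show ?thesis unfolding real_norm_def by linarith
  next
    case False
    then have "0 < f x - \<phi> x" by simp
    then show ?thesis by linarith
  qed
  then show ?thesis using that by blast
qed

text \<open>If two late terms were at distance \<open>e\<close>, the value at their midpoint would lie below the limit
  \<open>l\<close> by a fixed amount, contradicting the lower bound \<open>b\<close>. For a minimizing sequence \<open>b\<close> is the
  constant infimum; for projections onto nested sets it is the sequence of minimal values.\<close>

lemma Cauchy_of_midpoint_values:
  fixes \<phi> :: "'a \<Rightarrow>\<^sub>L real"
  assumes lim: "(\<lambda>n. f (X n) - \<phi> (X n)) \<longlonglongrightarrow> l" and b: "b \<longlonglongrightarrow> l"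
    and mid: "\<And>m n. n \<le> m \<Longrightarrow>
      b n \<le> f ((1/2) *\<^sub>R (X n + X m)) - \<phi> ((1/2) *\<^sub>R (X n + X m))"
  shows "Cauchy X"
proof (rule CauchyI')
  fix e :: real assume "0 < e"
  let ?g = "\<lambda>x. f x - \<phi> x"
  have "Bseq (\<lambda>n. ?g (X n))" using lim convergentI convergent_imp_Bseq by blast
  then obtain K where "\<And>n. \<bar>?g (X n)\<bar> \<le> K" unfolding Bseq_def by auto
  then have "range X \<subseteq> {x. ?g x \<le> K}" by (auto simp: abs_le_iff)
  then have "bounded (range X)" using bounded_sublevel bounded_subset by blast
  then obtain r where r: "0 < r" "\<And>n. norm (X n) \<le> r"
    unfolding bounded_pos by auto
  obtain c where c: "0 < c" "\<And>x y. norm x \<le> r \<Longrightarrow> norm y \<le> r \<Longrightarrow> e \<le> norm (x - y) \<Longrightarrow>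
       f ((1/2) *\<^sub>R (x + y)) + c \<le> (f x + f y) / 2"
    using midpoint_gap[OF r(1) \<open>0 < e\<close>] by blast
  have "\<forall>\<^sub>F n in sequentially. ?g (X n) < l + c / 2 \<and> l - c / 2 < b n"
    using order_tendstoD(2)[OF lim, of "l + c / 2"] order_tendstoD(1)[OF b, of "l - c / 2"] c
    by (auto intro: eventually_conj)
  then obtain M where M: "\<And>n. n \<ge> M \<Longrightarrow> ?g (X n) < l + c / 2 \<and> l - c / 2 < b n"
    unfolding eventually_sequentially by blast
  have "dist (X m) (X n) < e" if "m \<ge> M" "n > m" for m n
  proof (rule ccontr)
    assume "\<not> dist (X m) (X n) < e"
    then have "f ((1/2) *\<^sub>R (X m + X n)) + c \<le> (f (X m) + f (X n)) / 2"
      using c(2) r(2) by (auto simp: dist_norm)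
    from midpoint_gap_perturbed[OF this, of \<phi>] mid[of m n] M[of m] M[of n] that
    show False by (simp add: field_simps)
  qed
  then show "\<exists>M. \<forall>m\<ge>M. \<forall>n>m. dist (X m) (X n) < e" by blast
qed

lemma ex1_minimizer:
  fixes \<phi> :: "'a \<Rightarrow>\<^sub>L real"
  assumes "closed D" "convex D" "D \<noteq> {}"
  shows "\<exists>!z. z \<in> D \<and> (\<forall>x\<in>D. f z - \<phi> z \<le> f x - \<phi> x)"
proof -
  let ?g = "\<lambda>x. f x - \<phi> x"
  obtain m where m: "\<And>x. m \<le> ?g x" using bounded_below by blast
  define l where "l = (INF x\<in>D. ?g x)"
  have bdd: "bdd_below (?g ` D)" using m by (auto simp: bdd_below_def)
  have lower: "l \<le> ?g x" if "x \<in> D" for x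
    unfolding l_def by (rule cINF_lower[OF bdd that])
  have "\<exists>x\<in>D. ?g x < l + 1 / real (Suc n)" for n
    using cINF_less_iff[OF assms(3) bdd, of "l + 1 / real (Suc n)"] by (simp add: l_def)
  then obtain X where X: "\<And>n. X n \<in> D" "\<And>n. ?g (X n) < l + 1 / real (Suc n)"
    by metis
  have "(\<lambda>n. l + 1 / real (Suc n)) \<longlonglongrightarrow> l + 0"
    by (rule tendsto_add[OF tendsto_const LIMSEQ_Suc[OF lim_1_over_n]])
  then have "(\<lambda>n. l + 1 / real (Suc n)) \<longlonglongrightarrow> l" by (simp only: add_0_right)
  then have lim: "(\<lambda>n. ?g (X n)) \<longlonglongrightarrow> l"
    by (rule tendsto_sandwich[OF _ _ tendsto_const[of l], rotated 2])
      (rule always_eventually allI lower X less_imp_le)+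
  have mid: "(1/2) *\<^sub>R (x + y) \<in> D" if "x \<in> D" "y \<in> D" for x y
    using convexD[OF assms(2) that, of "1/2" "1/2"] by (simp add: scaleR_add_right)
  have "Cauchy X"
    by (rule Cauchy_of_midpoint_values[OF lim tendsto_const]) (intro lower mid X)
  then obtain z where z: "X \<longlonglongrightarrow> z" using Cauchy_convergent convergent_def by blast
  have "z \<in> D" using closed_sequentially[OF assms(1)] X z by blast
  have "(\<lambda>n. ?g (X n)) \<longlonglongrightarrow> ?g z"
    by (intro tendsto_intros blinfun.tendsto isCont_tendsto_compose[OF isCont_f] z)
  then have "?g z = l" using lim LIMSEQ_unique by blast
  show ?thesis
  proof (rule ex1I[of _ z])
    show "z \<in> D \<and> (\<forall>x\<in>D. ?g z \<le> ?g x)" using \<open>z \<in> D\<close> \<open>?g z = l\<close> lower by simp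
    fix z' assume z': "z' \<in> D \<and> (\<forall>x\<in>D. ?g z' \<le> ?g x)"
    then have "?g z' = l" using \<open>z \<in> D\<close> \<open>?g z = l\<close> lower[of z'] by force
    show "z' = z"
    proof (rule ccontr)
      assume "z' \<noteq> z"
      define r where "r = max (norm z) (norm z') + 1"
      have "0 < r" by (simp add: r_def add_nonneg_pos le_max_iff_disj)
      from midpoint_gap[OF this, of "norm (z' - z)"] \<open>z' \<noteq> z\<close>
      obtain c where "0 < c" "f ((1/2) *\<^sub>R (z' + z)) + c \<le> (f z' + f z) / 2"
        by (metis r_def add_increasing2 max.cobounded1 max.cobounded2 order_refl zero_le_one
            zero_less_norm_iff right_minus_eq)
      moreover have "l \<le> ?g ((1/2) *\<^sub>R (z' + z))"
        using lower mid \<open>z \<in> D\<close> z' by blast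
      ultimately show False
        using midpoint_gap_perturbed[of z' z c \<phi>] \<open>?g z' = l\<close> \<open>?g z = l\<close> by argo
    qed
  qed
qed

section \<open>Bregman projections\<close>

text \<open>As a function of its first argument the Bregman distance is \<open>f\<close> minus a continuous linear
  functional, up to a constant. This reduces projections to minimizers of such functions, and it
  makes differences of two Bregman distances affine.\<close>

lemma bregman_dist_affine:
  "bregman_dist f z x = (f z - grad f x z) + (grad f x x - f x)"
  by (simp add: bregman_dist_def blinfun.diff_right)

lemma has_bregman_proj:
  assumes "closed D" "convex D" "D \<noteq> {}"
  shows "has_bregman_proj f D x"
  using ex1_minimizer[OF assms, of "grad f x"]
  unfolding has_bregman_proj_def is_arg_min_linorder bregman_dist_affine Ball_def by simp

lemma bregman_proj_eq_iff:
  assumes "closed D" "convex D" "D \<noteq> {}"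
  shows "bregman_proj f D x = z \<longleftrightarrow>
    z \<in> D \<and> (\<forall>u\<in>D. bregman_dist f z x \<le> bregman_dist f u x)"
proof -
  have ex1: "\<exists>!z. is_arg_min (\<lambda>z. bregman_dist f z x) (\<lambda>z. z \<in> D) z"
    using has_bregman_proj[OF assms] unfolding has_bregman_proj_def .
  have "is_arg_min (\<lambda>z. bregman_dist f z x) (\<lambda>z. z \<in> D) (bregman_proj f D x)"
    unfolding bregman_proj_def arg_min_on_def arg_min_def by (rule someI_ex) (use ex1 in blast)
  then show ?thesis using ex1 unfolding is_arg_min_linorder by metis
qed

text \<open>The values \<open>D (X n) x\<close> increase with the shrinking sets and are bounded by the value at a
  common point, hence converge. For \<open>n \<le> m\<close> the midpoint of \<open>X n\<close> and \<open>X m\<close> lies in the \<open>n\<close>-th set,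
  where \<open>X n\<close> is optimal, so the sequence is Cauchy.\<close>

lemma nested_projections_converge:
  assumes closed: "\<And>n. closed (D n)" and convex: "\<And>n. convex (D n)"
    and anti: "\<And>m n. m \<le> n \<Longrightarrow> D n \<subseteq> D m" and p: "\<And>n. p \<in> D n"
    and X: "\<And>n. X n = bregman_proj f (D n) x"
  obtains z where "X \<longlonglongrightarrow> z" "\<And>n. z \<in> D n" "\<And>q. (\<And>n. q \<in> D n) \<Longrightarrow> bregman_dist f z x \<le> bregman_dist f q x"
proof -
  let ?d = "\<lambda>u. bregman_dist f u x"
  have ne: "D n \<noteq> {}" for n using p by blast
  have X_in: "X n \<in> D n" and X_le: "\<And>u. u \<in> D n \<Longrightarrow> ?d (X n) \<le> ?d u" for n
    using bregman_proj_eq_iff[OF closed convex ne, of n x "X n"] X by auto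
  have later: "X m \<in> D n" if "n \<le> m" for m n using anti[OF that] X_in by blast
  have inc: "incseq (\<lambda>n. ?d (X n))"
    unfolding incseq_def using X_le later by blast
  then obtain l where l: "(\<lambda>n. ?d (X n)) \<longlonglongrightarrow> l"
    by (rule incseq_convergent[where B = "?d p"]) (use X_le p in auto)
  let ?k = "grad f x x - f x"
  have shift: "(\<lambda>n. f (X n) - grad f x (X n)) \<longlonglongrightarrow> l - ?k"
    using tendsto_diff[OF l tendsto_const[of ?k]] by (simp add: bregman_dist_affine)
  have "Cauchy X"
  proof (rule Cauchy_of_midpoint_values[OF shift shift])
    fix m n :: nat assume "n \<le> m"
    then have "(1/2) *\<^sub>R (X n + X m) \<in> D n"
      using convexD[OF convex[of n] X_in[of n] later, of m "1/2" "1/2"]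
      by (simp add: scaleR_add_right)
    from X_le[OF this]
    show "f (X n) - grad f x (X n)
        \<le> f ((1/2) *\<^sub>R (X n + X m)) - grad f x ((1/2) *\<^sub>R (X n + X m))"
      unfolding bregman_dist_affine by simp
  qed
  then obtain z where z: "X \<longlonglongrightarrow> z" using Cauchy_convergent convergent_def by blast
  show ?thesis
  proof (rule that[OF z])
    show "z \<in> D n" for n
      by (rule Lim_in_closed_set[OF closed _ _ z])
        (auto simp: eventually_sequentially intro!: exI[of _ n] later)
    show "?d z \<le> ?d q" if "\<And>n. q \<in> D n" for q
      by (rule tendsto_upperbound[OF tendsto_bregman_dist[OF z tendsto_const]])
        (use X_le that in auto)
  qed
qed

section \<open>The gradient and its inverse\<close>

text \<open>The minimizer of \<open>f - \<phi>\<close> on the whole space satisfies the first-order condition.\<close>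

lemma surj_grad: "\<exists>u. grad f u = \<phi>"
proof -
  obtain u where u: "\<And>x. f u - \<phi> u \<le> f x - \<phi> x"
    using ex1_minimizer[of UNIV \<phi>] by auto
  have le: "\<phi> h \<le> grad f u h" for h
  proof -
    have "((\<lambda>t. (f (u + t *\<^sub>R h) - f u) / t) \<longlongrightarrow> grad f u h) (at_right 0)"
      using grad_limit by (rule filterlim_mono) (auto simp: at_le)
    then show ?thesis
    proof (rule tendsto_lowerbound)
      have "\<phi> h \<le> (f (u + t *\<^sub>R h) - f u) / t" if "0 < t" for t
        using u[of "u + t *\<^sub>R h"] that
        by (simp add: blinfun.add_right blinfun.scaleR_right field_simps)
      then show "\<forall>\<^sub>F t in at_right 0. \<phi> h \<le> (f (u + t *\<^sub>R h) - f u) / t"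
        by (simp add: eventually_at_filter)
    qed simp
  qed
  have "grad f u = \<phi>"
  proof (rule blinfun_eqI)
    fix h
    show "grad f u h = \<phi> h"
      using le[of h] le[of "- h"] by (simp add: blinfun.minus_right)
  qed
  then show ?thesis ..
qed

text \<open>Uniform convexity in terms of \<open>D\<close>: compare the value at the midpoint with the tangent at \<open>y\<close>.\<close>

lemma bregman_gap:
  assumes "0 < r" "0 < t"
  obtains c where "0 < c" "\<And>x y. norm x \<le> r \<Longrightarrow> norm y \<le> r \<Longrightarrow> t \<le> norm (x - y) \<Longrightarrow>
    c \<le> bregman_dist f x y"
proof -
  obtain c where c: "0 < c" "\<And>x y. norm x \<le> r \<Longrightarrow> norm y \<le> r \<Longrightarrow> t \<le> norm (x - y) \<Longrightarrow>
       f ((1/2) *\<^sub>R (x + y)) + c \<le> (f x + f y) / 2"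
    using midpoint_gap[OF assms] by blast
  show ?thesis
  proof (rule that[of "2 * c"])
    fix x y :: 'a
    assume "norm x \<le> r" "norm y \<le> r" "t \<le> norm (x - y)"
    then have "f ((1/2) *\<^sub>R (x + y)) + c \<le> (f x + f y) / 2" by (rule c(2))
    moreover have "f y + grad f y ((1/2) *\<^sub>R (x - y)) \<le> f ((1/2) *\<^sub>R (x + y))"
    proof -
      have "(1/2) *\<^sub>R (x + y) - y = (1/2) *\<^sub>R (x - y)"
        by (simp add: algebra_simps flip: scaleR_add_left)
      then show ?thesis using subgradient[of y "(1/2) *\<^sub>R (x + y)"] by simp
    qed
    ultimately show "2 * c \<le> bregman_dist f x y"
      by (simp add: bregman_dist_def blinfun.scaleR_right)
  qed (use c in simp)
qed

lemma tendsto_of_bregman_dist_bounded: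
  assumes bnd: "\<forall>\<^sub>F n in F. norm (X n) \<le> R" and lim: "((\<lambda>n. bregman_dist f x (X n)) \<longlongrightarrow> 0) F"
  shows "(X \<longlongrightarrow> x) F"
  unfolding tendsto_iff
proof (intro allI impI)
  fix e :: real assume "0 < e"
  define r where "r = max R (norm x) + 1"
  have "0 < r" by (simp add: r_def add_nonneg_pos le_max_iff_disj)
  then obtain c where c: "0 < c" "\<And>x y. norm x \<le> r \<Longrightarrow> norm y \<le> r \<Longrightarrow> e \<le> norm (x - y) \<Longrightarrow>
    c \<le> bregman_dist f x y" using bregman_gap \<open>0 < e\<close> by blast
  show "\<forall>\<^sub>F n in F. dist (X n) x < e"
    using bnd order_tendstoD(2)[OF lim c(1)]
  proof eventually_elim
    case (elim n)
    then show ?case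
      using c(2)[of x "X n"] by (force simp: r_def dist_norm norm_minus_commute)
  qed
qed

lemma bounded_bregman_sublevel: "bounded {y. bregman_dist f x y \<le> s}"
proof -
  have "bounded {y. bregman_dist f x y \<le> max s 1}"
    using admissible unfolding admissible_generator_def by simp
  then show ?thesis by (rule bounded_subset) auto
qed

lemma eventually_norm_le:
  assumes "\<forall>\<^sub>F n in F. bregman_dist f x (X n) \<le> s"
  obtains R where "\<forall>\<^sub>F n in F. norm (X n) \<le> R"
proof -
  obtain R where R: "\<And>y. bregman_dist f x y \<le> s \<Longrightarrow> norm y \<le> R"
    using bounded_bregman_sublevel[of x s] unfolding bounded_iff by blast
  show ?thesis by (rule that[OF eventually_mono[OF assms R]])
qed

text \<open>The sets \<open>{y. D x y \<le> r}\<close> are bounded, so vanishing distances alone confine the sequence to a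
  ball eventually.\<close>

lemma tendsto_of_bregman_dist:
  assumes lim: "((\<lambda>n. bregman_dist f x (X n)) \<longlongrightarrow> 0) F"
  shows "(X \<longlongrightarrow> x) F"
proof -
  have "\<forall>\<^sub>F n in F. bregman_dist f x (X n) \<le> 1"
    using order_tendstoD(2)[OF lim zero_less_one] by (auto elim: eventually_mono)
  then show ?thesis
    using eventually_norm_le tendsto_of_bregman_dist_bounded lim by metis
qed

text \<open>The symmetrized distance \<open>D x z + D z x\<close> is the pairing of the difference of gradients with
  the difference of points, which is small when the gradients are close and the points bounded.\<close>

lemma tendsto_of_grad:
  assumes bnd: "\<forall>\<^sub>F n in F. norm (X n) \<le> R" and lim: "((\<lambda>n. grad f (X n)) \<longlongrightarrow> grad f x) F"
  shows "(X \<longlongrightarrow> x) F"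
proof (rule tendsto_of_bregman_dist_bounded[OF bnd], rule Lim_null_comparison)
  show "\<forall>\<^sub>F n in F. norm (bregman_dist f x (X n)) \<le> norm (grad f x - grad f (X n)) * (norm x + R)"
    using bnd
  proof eventually_elim
    case (elim n)
    have "bregman_dist f x (X n) + bregman_dist f (X n) x = (grad f x - grad f (X n)) (x - X n)"
      by (simp add: bregman_dist_def blinfun.diff_left blinfun.diff_right)
    then have "bregman_dist f x (X n) \<le> norm ((grad f x - grad f (X n)) (x - X n))"
      using bregman_dist_nonneg[of "X n" x] by simp
    also have "\<dots> \<le> norm (grad f x - grad f (X n)) * norm (x - X n)" by (rule norm_blinfun)
    also have "\<dots> \<le> norm (grad f x - grad f (X n)) * (norm x + R)"
      using norm_triangle_ineq4[of x "X n"] elim by (intro mult_left_mono) auto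
    finally show ?case using bregman_dist_nonneg by simp
  qed
  have "((\<lambda>n. norm (grad f x - grad f (X n)) * (norm x + R)) \<longlongrightarrow>
      norm (grad f x - grad f x) * (norm x + R)) F"
    by (intro tendsto_intros lim)
  then show "((\<lambda>n. norm (grad f x - grad f (X n)) * (norm x + R)) \<longlongrightarrow> 0) F" by simp
qed

text \<open>The functional \<open>grad f x - grad f y\<close> separates \<open>x\<close> from \<open>y\<close>: its value at \<open>x - y\<close> is
  \<open>D x y + D y x\<close>, which is positive for distinct points.\<close>

lemma inj_bidual_embedding: "inj (bidual_embedding :: 'a \<Rightarrow> _)"
proof (rule injI)
  fix x y :: 'a assume "bidual_embedding x = bidual_embedding y"
  then have "\<phi> x = \<phi> y" for \<phi> :: "'a \<Rightarrow>\<^sub>L real"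
    by (metis bidual_embedding.rep_eq)
  then have "bregman_dist f x y + bregman_dist f y x = 0"
    by (simp add: bregman_dist_def blinfun.diff_right)
  then have "bregman_dist f x y = 0"
    using bregman_dist_nonneg[of x y] bregman_dist_nonneg[of y x] by simp
  then show "x = y"
    using tendsto_of_bregman_dist[of x "\<lambda>_. y" sequentially] by (simp add: LIMSEQ_const_iff)
qed

text \<open>The Fenchel-Young inequality is an equality at the gradient, by the subgradient inequality.\<close>

lemma conj_at_grad: "conj_fun f (grad f u) = ereal (grad f u u - f u)"
  unfolding fenchel_conjugate_def
proof (rule antisym[OF SUP_least])
  show "ereal (grad f u x) - ereal (f x) \<le> ereal (grad f u u - f u)" for x
    using subgradient[of u x] by (simp add: blinfun.diff_right)
  show "ereal (grad f u u - f u) \<le> (SUP x. ereal (grad f u x) - ereal (f x))"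
    by (rule SUP_upper2[of u]) auto
qed

text \<open>As the gradient is surjective, the conjugate is finite everywhere, so the Legendre property
  supplies a derivative \<open>A\<close> at \<open>grad f u\<close>. The affine function \<open>\<phi> \<mapsto> \<phi> u - f u\<close> lies below the
  conjugate and touches it at \<open>grad f u\<close>, which forces \<open>A\<close> to be evaluation at \<open>u\<close>.\<close>

lemma conj_gateaux_grad: "has_gateaux_derivative (conj_fun f) (bidual_embedding u) (grad f u)"
proof -
  have finite: "\<exists>s. conj_fun f \<phi> = ereal s" for \<phi>
    using surj_grad[of \<phi>] conj_at_grad by metis
  then have "edom (conj_fun f) = UNIV"
    unfolding edom_def by (metis (mono_tags) UNIV_eq_I mem_Collect_eq less_ereal.simps(4))
  moreover have "gateaux_differentiable_on (conj_fun f) (interior (edom (conj_fun f)))"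
    using admissible unfolding admissible_generator_def legendre_def by blast
  ultimately obtain A where A: "has_gateaux_derivative (conj_fun f) A (grad f u)"
    unfolding gateaux_differentiable_on_def by auto
  define F where "F = (\<lambda>\<phi>. real_of_ereal (conj_fun f \<phi>))"
  have F: "conj_fun f = (\<lambda>\<phi>. ereal (F \<phi>))"
    unfolding F_def using finite by (metis real_of_ereal.simps(1))
  have lower: "\<phi> u - f u \<le> F \<phi>" for \<phi> :: "'a \<Rightarrow>\<^sub>L real"
  proof -
    have "ereal (\<phi> u) - ereal (f u) \<le> conj_fun f \<phi>"
      unfolding fenchel_conjugate_def by (rule SUP_upper) simp
    then show ?thesis unfolding F by simp
  qed
  have at_u: "F (grad f u) = grad f u u - f u"
    by (simp add: F_def conj_at_grad)
  have le: "h u \<le> A h" for h :: "'a \<Rightarrow>\<^sub>L real"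
  proof -
    have "((\<lambda>t. (F (grad f u + t *\<^sub>R h) - F (grad f u)) / t) \<longlongrightarrow> A h) (at 0)"
      using A unfolding F has_gateaux_derivative_ereal_iff by blast
    then have "((\<lambda>t. (F (grad f u + t *\<^sub>R h) - F (grad f u)) / t) \<longlongrightarrow> A h) (at_right 0)"
      by (rule filterlim_mono) (auto simp: at_le)
    then show ?thesis
    proof (rule tendsto_lowerbound)
      have "h u \<le> (F (grad f u + t *\<^sub>R h) - F (grad f u)) / t" if "0 < t" for t
        using lower[of "grad f u + t *\<^sub>R h"] that at_u
        by (simp add: blinfun.add_left blinfun.scaleR_left field_simps)
      then show "\<forall>\<^sub>F t in at_right 0. h u \<le> (F (grad f u + t *\<^sub>R h) - F (grad f u)) / t"
        by (simp add: eventually_at_filter)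
    qed simp
  qed
  have "A = bidual_embedding u"
  proof (rule blinfun_eqI)
    fix h :: "'a \<Rightarrow>\<^sub>L real"
    show "A h = bidual_embedding u h"
      using le[of h] le[of "- h"]
      by (simp add: bidual_embedding.rep_eq blinfun.minus_left blinfun.minus_right)
  qed
  with A show ?thesis by simp
qed

lemma grad_conj_grad: "grad_conj f (grad f u) = u"
  unfolding grad_conj_def gateaux_gradient_eqI[OF conj_gateaux_grad]
  by (rule inv_f_f[OF inj_bidual_embedding])

lemma grad_grad_conj: "grad f (grad_conj f \<phi>) = \<phi>"
  using surj_grad[of \<phi>] grad_conj_grad by metis

lemma ex1_conj_gateaux:
  "\<exists>!u. has_gateaux_derivative (conj_fun f) (bidual_embedding u) \<phi>"
proof -
  obtain u where u: "grad f u = \<phi>" using surj_grad by blast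
  show ?thesis
    unfolding u[symmetric]
    by (rule ex1I[of _ u], rule conj_gateaux_grad)
      (metis has_gateaux_derivative_unique conj_gateaux_grad inj_bidual_embedding injD)
qed

section \<open>The half-spaces of the iteration\<close>

text \<open>By the three-point identity the excess of the right-hand side over the left is the average of
  the distances from \<open>y\<close> to \<open>x\<close> and \<open>z\<close>; the linear terms cancel by the choice of the gradient at \<open>y\<close>.\<close>

lemma bregman_dist_mixture:
  assumes "0 \<le> a" "a \<le> 1" "grad f y = a *\<^sub>R grad f x + (1 - a) *\<^sub>R grad f z"
  shows "bregman_dist f p y \<le> a * bregman_dist f p x + (1 - a) * bregman_dist f p z"
proof -
  have "a * bregman_dist f p x + (1 - a) * bregman_dist f p z - bregman_dist f p y
      = a * bregman_dist f y x + (1 - a) * bregman_dist f y z"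
    unfolding bregman_dist_def assms(3)
    by (simp add: blinfun.add_left blinfun.diff_left blinfun.scaleR_left blinfun.diff_right algebra_simps)
  moreover have "0 \<le> a * bregman_dist f y x + (1 - a) * bregman_dist f y z"
    using assms bregman_dist_nonneg by simp
  ultimately show ?thesis by linarith
qed

lemma bregman_halfspace:
  "{u. bregman_dist f u y \<le> bregman_dist f u w + c} =
     {u. (grad f w - grad f y) u \<le> grad f w w - f w - (grad f y y - f y) + c}"
  by (auto simp: bregman_dist_affine blinfun.diff_left)

lemma closed_convex_bregman_halfspace:
  "closed {u. bregman_dist f u y \<le> bregman_dist f u w + c}"
  "convex {u. bregman_dist f u y \<le> bregman_dist f u w + c}"
proof -
  let ?A = "grad f w - grad f y"
  have "closed {u. ?A u \<le> s}" for s
    by (intro closed_Collect_le continuous_intros)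
  moreover have "convex {u. ?A u \<le> s}" for s
  proof -
    have "{u. ?A u \<le> s} = ?A -` {..s}" by auto
    then show ?thesis
      by (simp add: convex_linear_vimage blinfun.bounded_linear_right bounded_linear.linear)
  qed
  ultimately show "closed {u. bregman_dist f u y \<le> bregman_dist f u w + c}"
    "convex {u. bregman_dist f u y \<le> bregman_dist f u w + c}"
    unfolding bregman_halfspace by blast+
qed

end

section \<open>Strong convergence of the projection method\<close>

theorem theorem4p4:
  fixes f :: "'a::banach \<Rightarrow> real"
    and T :: "nat \<Rightarrow> 'a \<Rightarrow> 'a"
    and \<Gamma> :: "('a \<Rightarrow> 'a) set"
    and \<epsilon> \<alpha> \<beta> :: "nat \<Rightarrow> real"
    and \<alpha>max :: real
    and v0 :: 'a
    and v w y :: "nat \<Rightarrow> 'a"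
    and C :: "nat \<Rightarrow> 'a set"
  assumes reflexive: "surj (bidual_embedding :: 'a \<Rightarrow> ('a \<Rightarrow>\<^sub>L real) \<Rightarrow>\<^sub>L real)"
    and admissible: "admissible_generator f"
    and closed_maps: "\<And>S. S \<in> \<Gamma> \<Longrightarrow> closed_mapping S"
    and fix_eq: "(\<Inter>k\<in>{1..}. Fix (T k)) = common_Fix \<Gamma>"
    and fix_nonempty: "common_Fix \<Gamma> \<noteq> {}"
    and fix_closed: "closed (common_Fix \<Gamma>)"
    and fix_convex: "convex (common_Fix \<Gamma>)"
    and NST: "NST_condition T \<Gamma>"
    and eps_nonneg: "\<And>k. k \<ge> 1 \<Longrightarrow> 0 \<le> \<epsilon> k"
    and eps_lim: "\<epsilon> \<longlonglongrightarrow> 0"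
    and quasi: "\<And>x p k. p \<in> common_Fix \<Gamma> \<Longrightarrow> k \<ge> 1 \<Longrightarrow>
                  bregman_dist f p (T k x) \<le> bregman_dist f p x + \<epsilon> k"
    and alpha_max: "\<alpha>max < 1"
    and alpha: "\<And>k. k \<ge> 1 \<Longrightarrow> 0 \<le> \<alpha> k \<and> \<alpha> k \<le> \<alpha>max"
    and beta: "bounded (\<beta> ` {1..})"
    and v_0: "v 0 = v0"
    and v_1: "v 1 = v0"
    and C_1: "C 1 = UNIV"
    and w_def: "\<And>k. k \<ge> 1 \<Longrightarrow> w k = v k + \<beta> k *\<^sub>R (v k - v (k - 1))"
    and y_def: "\<And>k. k \<ge> 1 \<Longrightarrow>
                  y k = grad_conj f (\<alpha> k *\<^sub>R grad f (w k) + (1 - \<alpha> k) *\<^sub>R grad f (T k (w k)))"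
    and C_Suc: "\<And>k. k \<ge> 1 \<Longrightarrow>
                  C (k + 1) = {u \<in> C k. bregman_dist f u (y k)
                                 \<le> bregman_dist f u (w k) + (1 - \<alpha> k) * \<epsilon> k}"
    and v_Suc: "\<And>k. k \<ge> 1 \<Longrightarrow> v (k + 1) = bregman_proj f (C (k + 1)) v0"
  shows "(\<forall>k\<ge>1. C k \<noteq> {} \<and> closed (C k) \<and> convex (C k)) \<and>
         (\<forall>k\<ge>1. (\<exists>!u. has_gateaux_derivative (conj_fun f) (bidual_embedding u)
                          (\<alpha> k *\<^sub>R grad f (w k) + (1 - \<alpha> k) *\<^sub>R grad f (T k (w k)))) \<and>
                 has_bregman_proj f (C (k + 1)) v0) \<and>
         has_bregman_proj f (common_Fix \<Gamma>) v0 \<and>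
         v \<longlonglongrightarrow> bregman_proj f (common_Fix \<Gamma>) v0"
proof -
  interpret bregman_generator f by unfold_locales (rule admissible)
  let ?F = "common_Fix \<Gamma>"
  obtain p where p: "p \<in> ?F" using fix_nonempty by blast
  have grad_y: "grad f (y k) = \<alpha> k *\<^sub>R grad f (w k) + (1 - \<alpha> k) *\<^sub>R grad f (T k (w k))" if "k \<ge> 1" for k
    unfolding y_def[OF that] grad_grad_conj ..
  have F_step: "bregman_dist f q (y k) \<le> bregman_dist f q (w k) + (1 - \<alpha> k) * \<epsilon> k"
    if "q \<in> ?F" "k \<ge> 1" for q k
  proof -
    have a: "0 \<le> \<alpha> k" "\<alpha> k \<le> 1" using alpha[OF that(2)] alpha_max by auto
    have "bregman_dist f q (y k)
        \<le> \<alpha> k * bregman_dist f q (w k) + (1 - \<alpha> k) * bregman_dist f q (T k (w k))"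
      by (rule bregman_dist_mixture[OF a grad_y[OF that(2)]])
    also have "\<dots> \<le> \<alpha> k * bregman_dist f q (w k) + (1 - \<alpha> k) * (bregman_dist f q (w k) + \<epsilon> k)"
      using a quasi[OF that] by (intro add_left_mono mult_left_mono) auto
    finally show ?thesis by (simp add: algebra_simps)
  qed
  have C_Int: "C (Suc k) = C k \<inter> {u. bregman_dist f u (y k)
      \<le> bregman_dist f u (w k) + (1 - \<alpha> k) * \<epsilon> k}" if "k \<ge> 1" for k
    using C_Suc[OF that] by auto
  have C: "?F \<subseteq> C k \<and> closed (C k) \<and> convex (C k)" if "k \<ge> 1" for k
    using that
  proof (induction k rule: dec_induct)
    case (step k)
    then show ?case
      using F_step unfolding C_Int[OF step.hyps(1)]
      by (auto intro!: closed_Int convex_Int closed_convex_bregman_halfspace)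
  qed (use C_1 in simp)
  have C_ne: "C k \<noteq> {}" if "k \<ge> 1" for k using C[OF that] p by blast
  have anti: "C (Suc n) \<subseteq> C (Suc m)" if "m \<le> n" for m n
    using that by (induction n rule: dec_induct) (auto simp: C_Int)
  \<comment> \<open>The starting point fits the scheme: \<open>v 1 = v0\<close> is the projection of \<open>v0\<close> onto the whole space.\<close>
  have v_proj: "v (Suc n) = bregman_proj f (C (Suc n)) v0" for n
  proof (cases n)
    case 0
    have "bregman_proj f UNIV v0 = v0"
      by (subst bregman_proj_eq_iff) (auto simp: bregman_dist_nonneg)
    then show ?thesis using 0 v_1 C_1 by simp
  next
    case (Suc m)
    then show ?thesis using v_Suc[of "Suc m"] by simp
  qed
  have p_in: "p \<in> C (Suc n)" for n using C[of "Suc n"] p by auto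
  obtain z where "(\<lambda>n. v (Suc n)) \<longlonglongrightarrow> z" and z_in: "\<And>n. z \<in> C (Suc n)"
    and z_le: "\<And>q. (\<And>n. q \<in> C (Suc n)) \<Longrightarrow> bregman_dist f z v0 \<le> bregman_dist f q v0"
    by (rule nested_projections_converge[of "\<lambda>n. C (Suc n)" p "\<lambda>n. v (Suc n)" v0])
      (use C p_in anti v_proj in auto)
  then have v: "v \<longlonglongrightarrow> z" using LIMSEQ_imp_Suc by blast

  have w: "w \<longlonglongrightarrow> z"
  proof -
    obtain b where b: "\<And>k. k \<ge> 1 \<Longrightarrow> \<bar>\<beta> k\<bar> \<le> b" using beta unfolding bounded_iff by auto
    have "(\<lambda>k. v (k - 1)) \<longlonglongrightarrow> z"
      by (rule LIMSEQ_imp_Suc) (simp add: v)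
    then have "(\<lambda>k. b * norm (v k - v (k - 1))) \<longlonglongrightarrow> b * norm (z - z)"
      by (intro tendsto_intros v)
    then have "(\<lambda>k. b * norm (v k - v (k - 1))) \<longlonglongrightarrow> 0" by simp
    moreover have "\<forall>\<^sub>F k in sequentially. norm (w k - v k) \<le> b * norm (v k - v (k - 1))"
      using eventually_ge_at_top[of 1]
      by eventually_elim (simp add: w_def b mult_right_mono)
    ultimately have "(\<lambda>k. w k - v k) \<longlonglongrightarrow> 0"
      by (rule Lim_null_comparison[rotated])
    from tendsto_add[OF this v] show ?thesis by simp
  qed

  have "(\<lambda>k. bregman_dist f z (y k)) \<longlonglongrightarrow> 0"
  proof (rule tendsto_sandwich[OF _ _ tendsto_const])
    show "\<forall>\<^sub>F k in sequentially. bregman_dist f z (y k) \<le> bregman_dist f z (w k) + \<epsilon> k"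
      using eventually_ge_at_top[of 1]
    proof eventually_elim
      case (elim k)
      have "bregman_dist f z (y k) \<le> bregman_dist f z (w k) + (1 - \<alpha> k) * \<epsilon> k"
        using z_in[of k] C_Int[OF elim] by auto
      moreover have "(1 - \<alpha> k) * \<epsilon> k \<le> \<epsilon> k"
        using alpha[OF elim] eps_nonneg[OF elim] by (simp add: mult_left_le_one_le algebra_simps)
      ultimately show ?case by linarith
    qed
    have "(\<lambda>k. bregman_dist f z (w k) + \<epsilon> k) \<longlonglongrightarrow> bregman_dist f z z + 0"
      by (intro tendsto_intros tendsto_bregman_dist w eps_lim)
    then show "(\<lambda>k. bregman_dist f z (w k) + \<epsilon> k) \<longlonglongrightarrow> 0" by simp
  qed (simp add: bregman_dist_nonneg)
  then have y: "y \<longlonglongrightarrow> z" by (rule tendsto_of_bregman_dist)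

  have grad_Tw: "(\<lambda>k. grad f (T k (w k))) \<longlonglongrightarrow> grad f z"
  proof -
    have gw: "(\<lambda>k. grad f (w k)) \<longlonglongrightarrow> grad f z" and gy: "(\<lambda>k. grad f (y k)) \<longlonglongrightarrow> grad f z"
      using isCont_tendsto_compose[OF isCont_grad] w y by blast+
    have "(\<lambda>k. norm (grad f (y k) - grad f (w k)) / (1 - \<alpha>max)) \<longlonglongrightarrow>
        norm (grad f z - grad f z) / (1 - \<alpha>max)"
      by (intro tendsto_intros gw gy) (use alpha_max in simp)
    then have "(\<lambda>k. norm (grad f (y k) - grad f (w k)) / (1 - \<alpha>max)) \<longlonglongrightarrow> 0" by simp
    moreover have "\<forall>\<^sub>F k in sequentially. norm (grad f (T k (w k)) - grad f (w k))
        \<le> norm (grad f (y k) - grad f (w k)) / (1 - \<alpha>max)"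
      using eventually_ge_at_top[of 1]
    proof eventually_elim
      case (elim k)
      have "grad f (y k) - grad f (w k) = (1 - \<alpha> k) *\<^sub>R (grad f (T k (w k)) - grad f (w k))"
        unfolding grad_y[OF elim] by (simp add: algebra_simps)
      then have "norm (grad f (y k) - grad f (w k)) =
          (1 - \<alpha> k) * norm (grad f (T k (w k)) - grad f (w k))"
        using alpha[OF elim] alpha_max by simp
      moreover have "(1 - \<alpha>max) * norm (grad f (T k (w k)) - grad f (w k))
          \<le> (1 - \<alpha> k) * norm (grad f (T k (w k)) - grad f (w k))"
        using alpha[OF elim] by (intro mult_right_mono) auto
      ultimately show ?case
        using alpha_max by (simp add: field_simps)
    qed
    ultimately have "(\<lambda>k. grad f (T k (w k)) - grad f (w k)) \<longlonglongrightarrow> 0"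
      by (rule Lim_null_comparison[rotated])
    from tendsto_add[OF this gw] show ?thesis by simp
  qed

  have Tw: "(\<lambda>k. T k (w k)) \<longlonglongrightarrow> z"
  proof -
    have "(\<lambda>k. bregman_dist f p (w k) + \<epsilon> k) \<longlonglongrightarrow> bregman_dist f p z + 0"
      by (intro tendsto_intros tendsto_bregman_dist w eps_lim)
    then have "\<forall>\<^sub>F k in sequentially. bregman_dist f p (w k) + \<epsilon> k < bregman_dist f p z + 1"
      by (rule order_tendstoD(2)) simp
    then have "\<forall>\<^sub>F k in sequentially. bregman_dist f p (T k (w k)) \<le> bregman_dist f p z + 1"
      using eventually_ge_at_top[of 1]
    proof eventually_elim
      case (elim k)
      then show ?case using quasi[OF p elim(2), of "w k"] by linarith
    qed
    then obtain R where "\<forall>\<^sub>F k in sequentially. norm (T k (w k)) \<le> R"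
      by (rule eventually_norm_le)
    then show ?thesis by (rule tendsto_of_grad[OF _ grad_Tw])
  qed

  have z_F: "z \<in> ?F"
    unfolding common_Fix_def Fix_def
  proof (intro INT_I CollectI)
    fix S assume S: "S \<in> \<Gamma>"
    have "(\<lambda>k. norm (w k - T k (w k))) \<longlonglongrightarrow> 0"
      using tendsto_norm[OF tendsto_diff[OF w Tw]] by simp
    moreover have "bounded (w ` {1..})"
      by (rule bounded_subset[OF convergent_imp_bounded[OF w]]) auto
    ultimately have "(\<lambda>k. norm (w k - S (w k))) \<longlonglongrightarrow> 0"
      using NST S unfolding NST_condition_def by blast
    then have "(\<lambda>k. w k - (w k - S (w k))) \<longlonglongrightarrow> z - 0"
      by (intro tendsto_diff w) (simp only: tendsto_norm_zero_iff)
    then have "(\<lambda>k. (w k, S (w k))) \<longlonglongrightarrow> (z, z)"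
      using w by (intro tendsto_Pair) simp_all
    moreover have "closed {(x, y). y = S x}"
      using closed_maps[OF S] unfolding closed_mapping_def .
    ultimately have "(z, z) \<in> {(x, y). y = S x}"
      by (rule closed_sequentially[rotated 2]) simp
    then show "S z = z" by simp
  qed

  have "bregman_proj f ?F v0 = z"
    unfolding bregman_proj_eq_iff[OF fix_closed fix_convex fix_nonempty]
  proof (intro conjI z_F ballI)
    fix q assume "q \<in> ?F"
    then have "q \<in> C (Suc n)" for n using C[of "Suc n"] by auto
    then show "bregman_dist f z v0 \<le> bregman_dist f q v0" by (rule z_le)
  qed
  then show ?thesis
    using C C_ne ex1_conj_gateaux has_bregman_proj fix_closed fix_convex fix_nonempty v by simp
qed

end
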